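(* Let $\Gamma$ be a vertex transitive graph on $n$ vertices of degree $k$ and $\Gamma'$ its complement. Then for each eigenvalue $\lambda \neq k$ of $\Gamma$ there is an eigenvalue $\lambda' = -\lambda-1$ of $\Gamma'$ of the same multiplicity, and the lattices $L_{\Gamma,\lambda}$ and $L_{\Gamma',\lambda'}$ (defined for rational $\lambda$) are the same.
   Context: Graphs are finite and simple; the eigenvalues of a graph, and their multiplicities, are those of its adjacency matrix. A graph is vertex transitive if for each pair of vertices $i,j$ some automorphism of the graph maps $i$ to $j$; such a graph is regular, and its degree is the common degree of its vertices. The complement $\Gamma'$ has the same vertices as $\Gamma$, and two distinct vertices are adjacent in $\Gamma'$ if and only if they are not adjacent in $\Gamma$. For a vertex transitive graph $\Delta$ on $n$ vertices and a rational eigenvalue $\lambda$ of $\Delta$, $L_{\Delta,\lambda} := P_{\Delta,\lambda}\mathbb{Z}^n$, where $P_{\Delta,\lambda}$ is the orthogonal projection of $\mathbb{R}^n$ onto the $\lambda$-eigenspace of the adjacency matrix of $\Delta$; it is a lattice of full rank in this eigenspace.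
   Formalization: Equality of multiplicities and of lattices is stated only when λ' = −λ−1 differs from n−1−k, the degree of Γ'; in that excluded case it always fails (e.g. K_2, λ = −1: multiplicity 1 in Γ but 2 in Γ'). That λ' is an eigenvalue of Γ' is stated for every λ ≠ k. *)

theory Defs
  imports "HOL-Analysis.Analysis"
begin

text \<open>
  A finite simple graph on \<open>n\<close> vertices is given by its adjacency relation on a finite vertex
  type \<open>'v\<close> with \<open>n = CARD('v)\<close>; vectors of \<open>\<real>\<^sup>n\<close> are indexed by the vertices.
\<close>

definition simple_graph :: "('v \<Rightarrow> 'v \<Rightarrow> bool) \<Rightarrow> bool" where
  "simple_graph E \<longleftrightarrow> symp E \<and> irreflp E"

definition graph_automorphism :: "('v \<Rightarrow> 'v \<Rightarrow> bool) \<Rightarrow> ('v \<Rightarrow> 'v) \<Rightarrow> bool" where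
  "graph_automorphism E f \<longleftrightarrow> bij f \<and> (\<forall>i j. E (f i) (f j) \<longleftrightarrow> E i j)"

definition vertex_transitive :: "('v \<Rightarrow> 'v \<Rightarrow> bool) \<Rightarrow> bool" where
  "vertex_transitive E \<longleftrightarrow> (\<forall>i j. \<exists>f. graph_automorphism E f \<and> f i = j)"

definition regular_of_degree :: "('v \<Rightarrow> 'v \<Rightarrow> bool) \<Rightarrow> nat \<Rightarrow> bool" where
  "regular_of_degree E k \<longleftrightarrow> (\<forall>i. card {j. E i j} = k)"

definition graph_complement :: "('v \<Rightarrow> 'v \<Rightarrow> bool) \<Rightarrow> 'v \<Rightarrow> 'v \<Rightarrow> bool" where
  "graph_complement E i j \<longleftrightarrow> i \<noteq> j \<and> \<not> E i j"

text \<open>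
  If \<open>\<Gamma>\<close> has \<open>n\<close> vertices and degree \<open>k\<close>, its complement has degree \<open>n - 1 - k\<close>.  When the
  complement is disconnected, the eigenvalue \<open>k - n\<close> of \<open>\<Gamma>\<close> corresponds to this degree, whose
  eigenspace in the complement also contains the all-ones vector and so is larger by one
  dimension.  Equality of multiplicities and of lattices is therefore only claimed for
  \<open>- \<mu> - 1 \<noteq> n - 1 - k\<close>; a complete bipartite graph with equal parts violates it otherwise.
\<close>

definition adjacency_matrix :: "('v::finite \<Rightarrow> 'v \<Rightarrow> bool) \<Rightarrow> real^'v^'v" where
  "adjacency_matrix E = (\<chi> i j. if E i j then 1 else 0)"

definition eigenspace :: "('v::finite \<Rightarrow> 'v \<Rightarrow> bool) \<Rightarrow> real \<Rightarrow> (real^'v) set" where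
  "eigenspace E \<mu> = {x. adjacency_matrix E *v x = \<mu> *\<^sub>R x}"

text \<open>
  The adjacency matrix is real symmetric, so all its eigenvalues are real, and geometric and
  algebraic multiplicities agree.
\<close>

definition graph_eigenvalue :: "('v::finite \<Rightarrow> 'v \<Rightarrow> bool) \<Rightarrow> real \<Rightarrow> bool" where
  "graph_eigenvalue E \<mu> \<longleftrightarrow> (\<exists>x. x \<noteq> 0 \<and> adjacency_matrix E *v x = \<mu> *\<^sub>R x)"

definition eigenvalue_multiplicity :: "('v::finite \<Rightarrow> 'v \<Rightarrow> bool) \<Rightarrow> real \<Rightarrow> nat" where
  "eigenvalue_multiplicity E \<mu> = dim (eigenspace E \<mu>)"

definition orthogonal_projection :: "'a::euclidean_space set \<Rightarrow> 'a \<Rightarrow> 'a" where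
  "orthogonal_projection S x = (THE p. p \<in> S \<and> (\<forall>y\<in>S. orthogonal (x - p) y))"

lemma orthogonal_projection_ex1:
  fixes S :: "'a::euclidean_space set"
  assumes "subspace S"
  shows "\<exists>!p. p \<in> S \<and> (\<forall>y\<in>S. orthogonal (x - p) y)"
proof -
  obtain p z where p: "p \<in> span S" and z: "\<And>w. w \<in> span S \<Longrightarrow> orthogonal z w" and x: "x = p + z"
    using orthogonal_subspace_decomp_exists by blast
  have S: "span S = S" using assms by (simp add: span_eq_iff)
  show ?thesis
  proof (rule ex1I[of _ p])
    show "p \<in> S \<and> (\<forall>y\<in>S. orthogonal (x - p) y)" using p z x S by auto
  next
    fix q assume q: "q \<in> S \<and> (\<forall>y\<in>S. orthogonal (x - q) y)"
    have d: "p - q \<in> S" using q p S assms by (metis subspace_diff)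
    then have "orthogonal (x - q) (p - q)" "orthogonal (x - p) (p - q)"
      using q z x S by auto
    then have "(p - q) \<bullet> (p - q) = 0"
      by (simp add: orthogonal_def inner_diff_left)
    then show "q = p" by simp
  qed
qed

lemma subspace_eigenspace: "subspace (eigenspace E \<mu>)"
  by (auto simp: eigenspace_def subspace_def matrix_vector_right_distrib
      matrix_vector_mult_scaleR scaleR_add_right)

definition integer_vectors :: "(real^'v::finite) set" where
  "integer_vectors = {x. \<forall>i. x $ i \<in> \<int>}"

text \<open>
  The set below is only considered for a rational eigenvalue; for irrational \<open>\<mu>\<close> it
  need not be a lattice.
\<close>

definition eigenspace_lattice :: "('v::finite \<Rightarrow> 'v \<Rightarrow> bool) \<Rightarrow> real \<Rightarrow> (real^'v) set" where
  "eigenspace_lattice E \<mu> = orthogonal_projection (eigenspace E \<mu>) ` integer_vectors"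

end

theory Submission
  imports Defs
begin

text \<open>
  In a graph of degree \<open>k\<close>, the coordinates of an eigenvector whose eigenvalue is not \<open>k\<close> sum to
  zero, so the matrix \<open>J - I - A\<close> of the complement multiplies it by \<open>- \<mu> - 1\<close>.  Since the
  complement is again regular and complementation is an involution, the two eigenspaces coincide,
  and multiplicities and lattices depend on the eigenspace only.
\<close>

lemma adjacency_matrix_mult_nth:
  "(adjacency_matrix E *v x) $ i = (\<Sum>j | E i j. x $ j)"
  by (simp add: adjacency_matrix_def matrix_vector_mult_def if_distrib[of "\<lambda>a. a * _"]
      sum.If_cases cong: if_cong)

text \<open>Double counting: after the summations are swapped, \<open>x $ j\<close> occurs once for
  each \<open>i\<close> with \<open>E i j\<close>. Symmetry turns these into the neighbours of
  \<open>j\<close>, of which there are \<open>k\<close>.\<close>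

lemma sum_adjacency_matrix_mult:
  assumes "symp E" and "regular_of_degree E k"
  shows "(\<Sum>i\<in>UNIV. (adjacency_matrix E *v x) $ i) = real k * (\<Sum>i\<in>UNIV. x $ i)"
proof -
  have "(\<Sum>i\<in>UNIV. (adjacency_matrix E *v x) $ i) = (\<Sum>j\<in>UNIV. \<Sum>i | E i j. x $ j)"
    using sum.swap_restrict[of UNIV UNIV "\<lambda>i j. x $ j" E]
    by (simp add: adjacency_matrix_mult_nth)
  also have "\<dots> = (\<Sum>j\<in>UNIV. real (card {i. E j i}) * x $ j)"
    using assms(1) by (auto simp: symp_def intro!: sum.cong arg_cong[where f = card])
  also have "\<dots> = real k * (\<Sum>j\<in>UNIV. x $ j)"
    using assms(2) by (simp add: regular_of_degree_def sum_distrib_left)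
  finally show ?thesis .
qed

text \<open>With s the coordinate sum of \<open>x\<close>, summing the coordinates of the
  eigenvector equation gives k * s = \<mu> * s, which forces s = 0.\<close>

lemma sum_eigenvector_eq_0:
  assumes "symp E" and "regular_of_degree E k" and "x \<in> eigenspace E \<mu>" and "\<mu> \<noteq> real k"
  shows "(\<Sum>i\<in>UNIV. x $ i) = 0"
  using sum_adjacency_matrix_mult[OF assms(1,2), of x] assms(3,4)
  by (simp add: eigenspace_def flip: sum_distrib_left)

lemma adjacency_matrix_graph_complement_mult_nth:
  assumes "irreflp E"
  shows "(adjacency_matrix (graph_complement E) *v x) $ i
    = (\<Sum>j\<in>UNIV. x $ j) - x $ i - (adjacency_matrix E *v x) $ i"
proof -
  \<comment> \<open>The vertices split into \<open>i\<close>, its neighbours and its non-neighbours;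
    irreflexivity keeps \<open>i\<close> out of the second class.\<close>
  have "UNIV = insert i ({j. E i j} \<union> {j. graph_complement E i j})"
    by (auto simp: graph_complement_def)
  moreover have "(\<Sum>j\<in>insert i ({j. E i j} \<union> {j. graph_complement E i j}). x $ j)
      = x $ i + ((\<Sum>j | E i j. x $ j) + (\<Sum>j | graph_complement E i j. x $ j))"
    using assms by (subst sum.insert) (auto simp: graph_complement_def irreflp_def
        intro!: sum.union_disjoint)
  ultimately show ?thesis
    by (simp add: adjacency_matrix_mult_nth)
qed

lemma simple_graph_graph_complement:
  "simple_graph E \<Longrightarrow> simple_graph (graph_complement E)"
  by (auto simp: simple_graph_def graph_complement_def symp_def irreflp_def)

lemma graph_complement_graph_complement:
  "irreflp E \<Longrightarrow> graph_complement (graph_complement E) = E"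
  by (auto simp: graph_complement_def irreflp_def fun_eq_iff)

text \<open>This bound ensures that the natural number \<open>CARD('v) - 1 - k\<close> is not
  truncated, so that it agrees with the real difference.\<close>

lemma regular_of_degree_less_card:
  fixes E :: "'v::finite \<Rightarrow> 'v \<Rightarrow> bool"
  assumes "irreflp E" and "regular_of_degree E k"
  shows "k < CARD('v)"
proof -
  fix i :: 'v
  have "{j. E i j} \<subset> UNIV"
    using assms(1) by (auto simp: irreflp_def)
  then show ?thesis
    using assms(2) psubset_card_mono[of UNIV "{j. E i j}"] by (simp add: regular_of_degree_def)
qed

lemma regular_of_degree_graph_complement:
  fixes E :: "'v::finite \<Rightarrow> 'v \<Rightarrow> bool"
  assumes "irreflp E" and "regular_of_degree E k"
  shows "regular_of_degree (graph_complement E) (CARD('v) - 1 - k)"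
proof -
  have "card {j. graph_complement E i j} = CARD('v) - 1 - k" for i
  proof -
    \<comment> \<open>Since \<open>i\<close> is not its own neighbour, the removed set has k + 1
      elements.\<close>
    have "{j. graph_complement E i j} = UNIV - insert i {j. E i j}"
      by (auto simp: graph_complement_def)
    then show ?thesis
      using assms by (simp add: card_Diff_subset regular_of_degree_def irreflp_def)
  qed
  then show ?thesis
    by (simp add: regular_of_degree_def)
qed

lemma eigenspace_subset_graph_complement:
  assumes "simple_graph E" and "regular_of_degree E k" and "\<mu> \<noteq> real k"
  shows "eigenspace E \<mu> \<subseteq> eigenspace (graph_complement E) (- \<mu> - 1)"
proof
  fix x assume x: "x \<in> eigenspace E \<mu>"
  have "symp E" and "irreflp E"
    using assms(1) by (auto simp: simple_graph_def)
  then show "x \<in> eigenspace (graph_complement E) (- \<mu> - 1)"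
    using sum_eigenvector_eq_0[OF _ assms(2) x assms(3)] x
    by (simp add: eigenspace_def vec_eq_iff adjacency_matrix_graph_complement_mult_nth
        algebra_simps)
qed

text \<open>The inclusion from right to left is the previous lemma. The other one is the same lemma
  for the complement and \<open>- \<mu> - 1\<close>, since \<mu> \<mapsto> - \<mu> - 1 is an
  involution too; the last hypothesis says that \<open>- \<mu> - 1\<close> is not the degree of the
  complement.\<close>

lemma eigenspace_graph_complement:
  fixes E :: "'v::finite \<Rightarrow> 'v \<Rightarrow> bool"
  assumes "simple_graph E" and "regular_of_degree E k" and "\<mu> \<noteq> real k"
    and "- \<mu> - 1 \<noteq> real CARD('v) - 1 - real k"
  shows "eigenspace (graph_complement E) (- \<mu> - 1) = eigenspace E \<mu>"
proof
  have irr: "irreflp E"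
    using assms(1) by (simp add: simple_graph_def)
  have "real (CARD('v) - 1 - k) = real CARD('v) - 1 - real k"
    using regular_of_degree_less_card[OF irr assms(2)] by (simp add: of_nat_diff)
  with assms(4) show "eigenspace (graph_complement E) (- \<mu> - 1) \<subseteq> eigenspace E \<mu>"
    using eigenspace_subset_graph_complement[OF simple_graph_graph_complement[OF assms(1)]
        regular_of_degree_graph_complement[OF irr assms(2)], of "- \<mu> - 1"]
    by (simp add: graph_complement_graph_complement[OF irr])
qed (rule eigenspace_subset_graph_complement[OF assms(1-3)])

theorem proposition4p5:
  fixes \<Gamma> :: "'v::finite \<Rightarrow> 'v \<Rightarrow> bool" and k :: nat
  assumes "simple_graph \<Gamma>"
    and "vertex_transitive \<Gamma>"
    and "regular_of_degree \<Gamma> k"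
  shows "\<forall>\<mu>::real. graph_eigenvalue \<Gamma> \<mu> \<and> \<mu> \<noteq> real k \<longrightarrow>
    graph_eigenvalue (graph_complement \<Gamma>) (- \<mu> - 1) \<and>
    (- \<mu> - 1 \<noteq> real CARD('v) - 1 - real k \<longrightarrow>
      eigenvalue_multiplicity (graph_complement \<Gamma>) (- \<mu> - 1) = eigenvalue_multiplicity \<Gamma> \<mu> \<and>
      (\<mu> \<in> \<rat> \<longrightarrow>
        eigenspace_lattice \<Gamma> \<mu> = eigenspace_lattice (graph_complement \<Gamma>) (- \<mu> - 1)))"
proof (intro allI impI conjI; elim conjE)
  fix \<mu> :: real
  assume ev: "graph_eigenvalue \<Gamma> \<mu>" and ne: "\<mu> \<noteq> real k"
  \<comment> \<open>One inclusion of eigenspaces already carries a nonzero eigenvector over, so this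
    also covers the case where \<open>- \<mu> - 1\<close> is the degree of the complement.\<close>
  show "graph_eigenvalue (graph_complement \<Gamma>) (- \<mu> - 1)"
    using ev eigenspace_subset_graph_complement[OF assms(1,3) ne]
    by (auto simp: graph_eigenvalue_def eigenspace_def)
  assume ne': "- \<mu> - 1 \<noteq> real CARD('v) - 1 - real k"
  note eq = eigenspace_graph_complement[OF assms(1,3) ne ne']
  show "eigenvalue_multiplicity (graph_complement \<Gamma>) (- \<mu> - 1) = eigenvalue_multiplicity \<Gamma> \<mu>"
    and "eigenspace_lattice \<Gamma> \<mu> = eigenspace_lattice (graph_complement \<Gamma>) (- \<mu> - 1)"
    by (simp_all only: eigenvalue_multiplicity_def eigenspace_lattice_def eq)
qed

end
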